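(* Let $\mathcal{H}$ be a separable complex Hilbert space, let $J\subseteq\mathbb{N}$ be an index set, and let $T$, $T_j$, $j\in J$, be closed symmetric operators in $\mathcal{H}$. Suppose there exist $\Phi_j\in\mathcal{B}(\mathcal{H})$ and $\widetilde\Phi_j\in\mathcal{B}(\mathcal{H})$, $j\in J$, such that $$\Phi=\sum_{j\in J}\Phi_j\in\mathcal{B}(\mathcal{H}),$$ with convergence in the strong operator topology, and such that: (1) $\widetilde\Phi_j\Phi_j=\Phi_j$ for $j\in J$, and $\widetilde\Phi_j\Phi_k=0$ for $j,k\in J$, $j\ne k$; (2) $g\in\mathrm{dom}(T_j^* )$ implies $\Phi_jg\in\mathrm{dom}(T^* )$, $j\in J$; (3) $g\in\mathrm{dom}(T^* )$ implies $\Phi_jg\in\mathrm{dom}(T_j^* )$, $j\in J$; (4) $g\in\mathrm{dom}(T_j)$ implies $\widetilde\Phi_jg\in\mathrm{dom}(T)$, $j\in J$; (5) $g\in\mathrm{dom}(T)$ implies $\widetilde\Phi_jg\in\mathrm{dom}(T_j)$, $j\in J$; (6) $g\in\mathrm{dom}(T_j^* )$ implies $(I_{\mathcal{H}}-\Phi_j)g\in\mathrm{dom}(T_j)$, $j\in J$; (7) $g\in\mathrm{dom}(T^* )$ implies $\big(I_{\mathcal{H}}-\sum_{j\in J}\Phi_j\big)g\in\mathrm{dom}(T)$; (8) $g\in\mathrm{dom}(T^* )$ implies $$\lim_{N\to\infty}T^*\Big(\sum_{j\in J,\ |j|\le N}\Phi_jg\Big)=T^*\Big(\sum_{j\in J}\Phi_jg\Big)$$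 in the norm of $\mathcal{H}$ (this condition being redundant if $J$ is finite). Then $$\mathrm{def}(T)=\sum_{j\in J}\mathrm{def}(T_j),$$ including the possibility that one, and hence both sides equal $\infty$.
   Context: $\mathcal{B}(\mathcal{H})$ denotes the bounded linear operators on $\mathcal{H}$. A densely defined operator $A$ in $\mathcal{H}$ is symmetric if $A\subseteq A^*$. For a symmetric operator $A$, the deficiency indices are $n_\pm(A)=\dim(\ker(A^*\mp iI_{\mathcal{H}}))$, and the defect is $\mathrm{def}(A)=[n_+(A)+n_-(A)]/2\in[0,\infty]$ (all infinite dimensions being recorded simply as $\infty$). *)

theory Defs
  imports "HOL-Analysis.Analysis"
begin

section \<open>Complex Hilbert spaces\<close>

text \<open>
  The real structure (vector space, norm, metric, topology) is that of \<^class>\<open>real_inner\<close>; a complex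
  inner product induces it through its real part. The inner product is antilinear in the first and
  linear in the second argument; positivity and the norm formula are derived below.
\<close>

class complex_inner = real_inner +
  fixes scaleC :: "complex \<Rightarrow> 'a \<Rightarrow> 'a"  (infixr \<open>*\<^sub>C\<close> 75)
    and cinner :: "'a \<Rightarrow> 'a \<Rightarrow> complex"
  assumes scaleC_add_right: "a *\<^sub>C (x + y) = a *\<^sub>C x + a *\<^sub>C y"
    and scaleC_add_left: "(a + b) *\<^sub>C x = a *\<^sub>C x + b *\<^sub>C x"
    and scaleC_scaleC: "a *\<^sub>C (b *\<^sub>C x) = (a * b) *\<^sub>C x"
    and scaleC_of_real: "complex_of_real r *\<^sub>C x = r *\<^sub>R x"
    and cinner_commute: "cinner x y = cnj (cinner y x)"
    and cinner_add_right: "cinner x (y + z) = cinner x y + cinner x z"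
    and cinner_scaleC_right: "cinner x (a *\<^sub>C y) = a * cinner x y"
    and Re_cinner: "Re (cinner x y) = inner x y"

class chilbert_space = complex_inner + complete_space

lemma scaleC_one: "1 *\<^sub>C x = (x :: 'a::complex_inner)"
  using scaleC_of_real[of 1 x] by simp

global_interpretation complex_vector: vector_space "scaleC :: complex \<Rightarrow> 'a \<Rightarrow> 'a::complex_inner"
  by unfold_locales
    (simp_all add: scaleC_add_right scaleC_add_left scaleC_scaleC scaleC_one)

lemma cinner_same: "cinner x x = complex_of_real (inner x x)"
  for x :: "'a::complex_inner"
proof (rule complex_eqI)
  have "Im (cinner x x) = - Im (cinner x x)"
    using cinner_commute[of x x] by (metis cnj.simps(2))
  then show "Im (cinner x x) = Im (complex_of_real (inner x x))" by simp
qed (simp add: Re_cinner)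

lemma norm_eq_sqrt_cinner: "complex_of_real ((norm x)\<^sup>2) = cinner x x"
  for x :: "'a::complex_inner"
  by (simp add: cinner_same dot_square_norm)

instantiation complex :: chilbert_space
begin
definition scaleC_complex :: "complex \<Rightarrow> complex \<Rightarrow> complex" where "scaleC_complex a x = a * x"
definition cinner_complex :: "complex \<Rightarrow> complex \<Rightarrow> complex" where "cinner_complex x y = cnj x * y"
instance
  by standard
    (auto simp: scaleC_complex_def cinner_complex_def inner_complex_def algebra_simps scaleR_conv_of_real)
end

definition bounded_clinear :: "('a::complex_inner \<Rightarrow> 'a) \<Rightarrow> bool" where
  "bounded_clinear B \<longleftrightarrow> bounded_linear B \<and> (\<forall>c x. B (c *\<^sub>C x) = c *\<^sub>C B x)"

section \<open>Unbounded operators\<close>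

text \<open>
  An operator in the Hilbert space is a partial function \<open>A :: 'a \<rightharpoonup> 'a\<close> with domain \<^term>\<open>dom A\<close>.
  Inclusion \<open>A \<subseteq> B\<close> of operators is then \<^term>\<open>A \<subseteq>\<^sub>m B\<close>, and the value at a point \<open>g\<close> of the domain
  is \<^term>\<open>the (A g)\<close>.
\<close>

definition linear_operator :: "('a::complex_inner \<rightharpoonup> 'a) \<Rightarrow> bool" where
  "linear_operator A \<longleftrightarrow>
     complex_vector.subspace (dom A) \<and>
     (\<forall>x\<in>dom A. \<forall>y\<in>dom A. the (A (x + y)) = the (A x) + the (A y)) \<and>
     (\<forall>c. \<forall>x\<in>dom A. the (A (c *\<^sub>C x)) = c *\<^sub>C the (A x))"

definition densely_defined :: "('a::complex_inner \<rightharpoonup> 'a) \<Rightarrow> bool" where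
  "densely_defined A \<longleftrightarrow> closure (dom A) = UNIV"

definition closed_operator :: "('a::complex_inner \<rightharpoonup> 'a) \<Rightarrow> bool" where
  "closed_operator A \<longleftrightarrow> closed (Map.graph A)"

text \<open>For densely defined \<open>A\<close> the vector \<open>h\<close> is unique, which makes the description legitimate.\<close>

definition adjoint_operator :: "('a::complex_inner \<rightharpoonup> 'a) \<Rightarrow> ('a \<rightharpoonup> 'a)" where
  "adjoint_operator A = (\<lambda>g.
     if \<exists>h. \<forall>f\<in>dom A. cinner g (the (A f)) = cinner h f
     then Some (THE h. \<forall>f\<in>dom A. cinner g (the (A f)) = cinner h f)
     else None)"

definition symmetric_operator :: "('a::complex_inner \<rightharpoonup> 'a) \<Rightarrow> bool" where
  "symmetric_operator A \<longleftrightarrow>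
     linear_operator A \<and> densely_defined A \<and> A \<subseteq>\<^sub>m adjoint_operator A"

text \<open>The operator \<open>A - z I\<close>, with the domain of \<open>A\<close>.\<close>

definition minus_scalar :: "('a::complex_inner \<rightharpoonup> 'a) \<Rightarrow> complex \<Rightarrow> ('a \<rightharpoonup> 'a)" where
  "minus_scalar A z = (\<lambda>x. map_option (\<lambda>y. y - z *\<^sub>C x) (A x))"

definition ker_operator :: "('a::complex_inner \<rightharpoonup> 'a) \<Rightarrow> 'a set" where
  "ker_operator A = {x. A x = Some 0}"

text \<open>
  Complex dimension of a subspace, all infinite dimensions being \<open>\<infinity>\<close>
  (\<^const>\<open>complex_vector.dim\<close> is \<open>0\<close> on infinite-dimensional subspaces).
\<close>

definition ecdim :: "'a::complex_inner set \<Rightarrow> enat" where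
  "ecdim S = (if \<exists>B. finite B \<and> S \<subseteq> complex_vector.span B
              then enat (complex_vector.dim S) else \<infinity>)"

definition deficiency_plus :: "('a::complex_inner \<rightharpoonup> 'a) \<Rightarrow> enat" where
  "deficiency_plus A = ecdim (ker_operator (minus_scalar (adjoint_operator A) \<i>))"

definition deficiency_minus :: "('a::complex_inner \<rightharpoonup> 'a) \<Rightarrow> enat" where
  "deficiency_minus A = ecdim (ker_operator (minus_scalar (adjoint_operator A) (- \<i>)))"

text \<open>The defect may be a half-integer, so it is taken in \<^typ>\<open>ennreal\<close>.\<close>

definition defect :: "('a::complex_inner \<rightharpoonup> 'a) \<Rightarrow> ennreal" where
  "defect A = (ennreal_of_enat (deficiency_plus A) + ennreal_of_enat (deficiency_minus A)) / 2"

end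

theory Submission
  imports Defs
begin

text \<open>
  By von Neumann, a closed symmetric operator \<open>A\<close> satisfies
  \<open>dom A\<^sup>* = dom A \<oplus> ker (A\<^sup>* - i) \<oplus> ker (A\<^sup>* + i)\<close>, so \<open>def A\<close> is half the dimension of the
  quotient \<open>dom A\<^sup>* / dom A\<close>. The defect formula is therefore a statement about these quotients,
  and it holds because the operators \<open>\<Phi>\<^sub>j\<close> induce an embedding of \<open>dom T\<^sup>* / dom T\<close> into the
  product of the quotients \<open>dom T\<^sub>j\<^sup>* / dom T\<^sub>j\<close> whose image contains their direct sum.

  Writing \<open>\<Psi>\<^sub>j\<close> for \<open>\<Phi>\<^sub>j\<close> with a tilde, everything rests on the identity \<open>\<Psi>\<^sub>k \<Phi> = \<Phi>\<^sub>k\<close>, obtained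
  from \<open>c1\<close> by continuity of \<open>\<Psi>\<^sub>k\<close>.

  \<^item> The induced map is well defined: for \<open>w \<in> dom T\<close>, \<open>c7\<close> gives \<open>\<Phi> w \<in> dom T\<close>, and
    hence \<open>\<Phi>\<^sub>j w = \<Psi>\<^sub>j \<Phi> w \<in> dom T\<^sub>j\<close> by \<open>c5\<close>.

  \<^item> It is injective: if \<open>\<Phi>\<^sub>j v \<in> dom T\<^sub>j\<close> for all \<open>j\<close>, then \<open>\<Phi>\<^sub>j v = \<Psi>\<^sub>j \<Phi>\<^sub>j v \<in> dom T\<close> by \<open>c4\<close>; the
    partial sums of \<open>\<Phi> v\<close> lie in \<open>dom T\<close>, their images under \<open>T\<close> converge by \<open>c8\<close>, and \<open>T\<close> is
    closed, so \<open>\<Phi> v \<in> dom T\<close> and \<open>v \<in> dom T\<close> by \<open>c7\<close>.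

  \<^item> Its image contains the direct sum: for \<open>v \<in> dom T\<^sub>j\<^sup>*\<close>, the vector \<open>\<Phi>\<^sub>j v\<close> is mapped to the class
    of \<open>v\<close> in component \<open>j\<close> and to zero in every other component, because
    \<open>\<Phi>\<^sub>k \<Phi>\<^sub>j v\<close> differs from \<open>\<Psi>\<^sub>k \<Phi>\<^sub>j v\<close> by an element of \<open>dom T\<^sub>k\<close> (\<open>c7\<close> and \<open>c5\<close>) and
    \<open>\<Phi>\<^sub>j v\<close> differs from \<open>v\<close> by an element of \<open>dom T\<^sub>j\<close> (\<open>c6\<close>).

  If only finitely many of the quotients are nonzero, their product and direct sum agree and
  the dimensions add up; if infinitely many are nonzero, both sides are infinite. The linear algebra
  is isolated in the locale \<open>quotient_splitting\<close>, and the analysis is in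
  \<open>von_neumann_decomposition\<close>, which rests on the projection onto a closed subspace.
\<close>

section \<open>Complex inner products and orthogonal projection\<close>

lemma cinner_add_left: "cinner (x + y) z = cinner x z + cinner y (z :: 'a::complex_inner)"
  by (metis cinner_add_right cinner_commute complex_cnj_add)

lemma cinner_scaleC_left: "cinner (c *\<^sub>C x) y = cnj c * cinner x (y :: 'a::complex_inner)"
  by (metis cinner_commute cinner_scaleC_right complex_cnj_mult)

lemma cinner_diff_right: "cinner x (y - z) = cinner x y - cinner x (z :: 'a::complex_inner)"
  by (metis add_diff_cancel cinner_add_right diff_add_cancel)

lemma cinner_diff_left: "cinner (x - y) z = cinner x z - cinner y (z :: 'a::complex_inner)"
  by (metis add_diff_cancel cinner_add_left diff_add_cancel)

lemma norm_scaleC: "norm (c *\<^sub>C x) = cmod c * norm (x :: 'a::complex_inner)"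
proof -
  have "complex_of_real ((norm (c *\<^sub>C x))\<^sup>2) = (cnj c * c) * cinner x x"
    unfolding norm_eq_sqrt_cinner by (simp add: cinner_scaleC_left cinner_scaleC_right)
  also have "cnj c * c = complex_of_real ((cmod c)\<^sup>2)"
    by (metis complex_norm_square mult.commute)
  also have "\<dots> * cinner x x = complex_of_real ((cmod c * norm x)\<^sup>2)"
    by (simp add: norm_eq_sqrt_cinner[symmetric] power_mult_distrib)
  finally have "(norm (c *\<^sub>C x))\<^sup>2 = (cmod c * norm x)\<^sup>2" by (simp only: of_real_eq_iff)
  then show ?thesis by (simp add: power2_eq_iff_nonneg)
qed

lemma tendsto_scaleC:
  assumes "(f \<longlongrightarrow> l) F"
  shows "((\<lambda>x. c *\<^sub>C f x) \<longlongrightarrow> c *\<^sub>C (l :: 'a::complex_inner)) F"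
proof -
  have "((\<lambda>x. norm (c *\<^sub>C (f x - l))) \<longlongrightarrow> 0) F"
    unfolding norm_scaleC using assms
    by (intro tendsto_mult_right_zero) (simp add: LIM_zero tendsto_norm_zero)
  then show ?thesis
    by (simp add: complex_vector.scale_right_diff_distrib tendsto_norm_zero_iff LIM_zero_iff)
qed

text \<open>
  Only the real part of the inner product is needed: \<open>inner u\<close> is continuous, so it vanishes on the
  closure, in particular at \<open>u\<close> itself.
\<close>

lemma cinner_dense_imp_zero:
  fixes D :: "'a::complex_inner set"
  assumes "closure D = UNIV" and "\<And>f. f \<in> D \<Longrightarrow> cinner u f = 0"
  shows "u = 0"
proof -
  have "D \<subseteq> {f. inner u f = 0}" using assms(2) by (auto simp flip: Re_cinner)
  moreover have "closed {f. inner u f = 0}"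
    by (intro closed_Collect_eq continuous_intros)
  ultimately have "closure D \<subseteq> {f. inner u f = 0}" by (rule closure_minimal)
  then have "inner u u = 0" using assms(1) by blast
  then show ?thesis by simp
qed

text \<open>
  Completeness replaces compactness here. By the parallelogram law and convexity, points of \<open>M\<close>
  whose distance to \<open>x\<close> is close to the infimum are close to each other, so every minimizing sequence
  is Cauchy.
\<close>

lemma nearest_point_exists:
  fixes M :: "'a::{real_inner, complete_space} set"
  assumes M: "closed M" "convex M" "M \<noteq> {}"
  obtains m where "m \<in> M" "\<And>y. y \<in> M \<Longrightarrow> norm (x - m) \<le> norm (x - y)"
proof -
  define d where "d = infdist x M"
  have d0: "d \<ge> 0" by (simp add: d_def infdist_nonneg)
  have d: "d \<le> norm (x - y)" if "y \<in> M" for y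
    using that by (simp add: d_def infdist_le dist_norm[symmetric])
  have "\<exists>y\<in>M. norm (x - y) < d + 1 / real (Suc n)" for n
    using cInf_lessD[of "dist x ` M" "d + 1 / real (Suc n)"] M(3)
    by (auto simp: d_def infdist_def dist_norm)
  then obtain y where y: "\<And>n. y n \<in> M" "\<And>n. norm (x - y n) < d + 1 / real (Suc n)" by metis
  have key: "(norm (y m - y n))\<^sup>2 \<le> (8 * d + 4) / real (Suc N)" if "m \<ge> N" "n \<ge> N" for m n N
  proof -
    let ?e = "1 / real (Suc N)"
    have le: "norm (x - y k) \<le> d + ?e" if "k \<ge> N" for k
    proof -
      have "1 / real (Suc k) \<le> ?e" using that by (simp add: frac_le)
      then show ?thesis using y(2)[of k] by linarith
    qed
    \<comment> \<open>The midpoint lies in \<open>M\<close>, so its distance to \<open>x\<close> bounds \<open>d\<close> from above.\<close>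
    have "(1/2) *\<^sub>R y m + (1/2) *\<^sub>R y n \<in> M"
      using M(2) y(1) by (intro convexD) auto
    from d[OF this] have "d\<^sup>2 \<le> (norm (x - ((1/2) *\<^sub>R y m + (1/2) *\<^sub>R y n)))\<^sup>2"
      using d0 by (intro power_mono) auto
    also have "4 * \<dots> = 2 * (norm (x - y m))\<^sup>2 + 2 * (norm (x - y n))\<^sup>2 - (norm (y m - y n))\<^sup>2"
      by (simp add: power2_norm_eq_inner algebra_simps inner_commute)
    finally have "(norm (y m - y n))\<^sup>2 \<le> 2 * (norm (x - y m))\<^sup>2 + 2 * (norm (x - y n))\<^sup>2 - 4 * d\<^sup>2"
      by simp
    also have "\<dots> \<le> 2 * (d + ?e)\<^sup>2 + 2 * (d + ?e)\<^sup>2 - 4 * d\<^sup>2"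
      using le that by (intro diff_right_mono add_mono mult_left_mono power_mono) auto
    also have "\<dots> = 8 * d * ?e + 4 * (?e * ?e)" by (simp add: power2_eq_square algebra_simps)
    also have "\<dots> \<le> 8 * d * ?e + 4 * (?e * 1)"
      by (intro add_left_mono mult_left_mono) auto
    also have "\<dots> = (8 * d + 4) / real (Suc N)" by (simp add: add_divide_distrib)
    finally show ?thesis .
  qed
  have "Cauchy y"
  proof (rule metric_CauchyI)
    fix e :: real assume e: "e > 0"
    have "(\<lambda>N. (8 * d + 4) / real (Suc N)) \<longlonglongrightarrow> 0"
      by (rule LIMSEQ_Suc[OF lim_const_over_n])
    then have "\<forall>\<^sub>F N in sequentially. (8 * d + 4) / real (Suc N) < e\<^sup>2"
      using e by (intro order_tendstoD(2)) auto
    then obtain N where N: "(8 * d + 4) / real (Suc N) < e\<^sup>2"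
      by (auto simp: eventually_sequentially)
    have "dist (y m) (y n) < e" if "m \<ge> N" "n \<ge> N" for m n
    proof -
      have "(norm (y m - y n))\<^sup>2 < e\<^sup>2" using key[OF that] N by linarith
      then show ?thesis using e by (simp add: dist_norm power_less_imp_less_base)
    qed
    then show "\<exists>N. \<forall>m\<ge>N. \<forall>n\<ge>N. dist (y m) (y n) < e" by blast
  qed
  then obtain m where m: "y \<longlonglongrightarrow> m" using Cauchy_convergent convergent_def by blast
  have "m \<in> M" using M(1) y(1) m closed_sequentially by blast
  moreover have "norm (x - m) \<le> d"
  proof (rule LIMSEQ_le)
    show "(\<lambda>n. norm (x - y n)) \<longlonglongrightarrow> norm (x - m)" by (intro tendsto_intros m)
    have "(\<lambda>n. d + 1 / real (Suc n)) \<longlonglongrightarrow> d + 0"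
      by (intro tendsto_intros LIMSEQ_Suc[OF lim_const_over_n])
    then show "(\<lambda>n. d + 1 / real (Suc n)) \<longlonglongrightarrow> d" by simp
    show "\<exists>N. \<forall>n\<ge>N. norm (x - y n) \<le> d + 1 / real (Suc n)" using y(2) less_imp_le by blast
  qed
  ultimately show ?thesis using that d order_trans by blast
qed

text \<open>
  The residual at a nearest point is orthogonal to \<open>M\<close>: otherwise a small step along \<open>y\<close> would
  come closer to \<open>x\<close>. This gives orthogonality for the real inner product; replacing \<open>y\<close> by
  \<open>\<i> *\<^sub>C y\<close> gives it for the imaginary part of the complex one.
\<close>

lemma orthogonal_decomposition:
  fixes M :: "'a::chilbert_space set"
  assumes M: "closed M" "complex_vector.subspace M"
  obtains m where "m \<in> M" "\<And>y. y \<in> M \<Longrightarrow> cinner (x - m) y = 0"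
proof -
  have conv: "convex M"
    using M(2) unfolding convex_def
    by (metis complex_vector.subspace_add complex_vector.subspace_scale scaleC_of_real)
  have "M \<noteq> {}" using complex_vector.subspace_0[OF M(2)] by blast
  with M(1) conv obtain m where m: "m \<in> M" "\<And>y. y \<in> M \<Longrightarrow> norm (x - m) \<le> norm (x - y)"
    using nearest_point_exists by metis
  have inner0: "inner (x - m) y = 0" if y: "y \<in> M" for y
  proof (cases "y = 0")
    case False
    \<comment> \<open>The step length that minimizes \<open>norm (x - m - t *\<^sub>R y)\<close>.\<close>
    define t where "t = inner (x - m) y / inner y y"
    have yy: "inner y y > 0" using False by simp
    have "m + t *\<^sub>R y \<in> M"
      using M(2) m(1) y by (metis complex_vector.subspace_add complex_vector.subspace_scale scaleC_of_real)
    from m(2)[OF this] have "(norm (x - m))\<^sup>2 \<le> (norm ((x - m) - t *\<^sub>R y))\<^sup>2"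
      by (intro power_mono) (auto simp: algebra_simps)
    also have "\<dots> = (norm (x - m))\<^sup>2 - 2 * t * inner (x - m) y + t * t * inner y y"
      unfolding power2_norm_eq_inner
      by (simp only: inner_diff_left inner_diff_right inner_scaleR_left inner_scaleR_right
          inner_commute[of y x] inner_commute[of y m] inner_commute[of m x]) (simp add: algebra_simps)
    also have "\<dots> = (norm (x - m))\<^sup>2 - (inner (x - m) y)\<^sup>2 / inner y y"
      using yy by (simp add: t_def field_simps power2_eq_square)
    finally have "(inner (x - m) y)\<^sup>2 \<le> 0" using yy by (simp add: divide_le_0_iff)
    then show ?thesis by simp
  qed simp
  have "cinner (x - m) y = 0" if y: "y \<in> M" for y
  proof (rule complex_eqI)
    show "Re (cinner (x - m) y) = Re 0" by (simp add: Re_cinner inner0 y)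
    have "cinner (x - m) (\<i> *\<^sub>C y) = \<i> * cinner (x - m) y" by (rule cinner_scaleC_right)
    then have "Im (cinner (x - m) y) = - Re (cinner (x - m) (\<i> *\<^sub>C y))" by simp
    also have "\<dots> = 0" by (simp add: Re_cinner inner0 complex_vector.subspace_scale M(2) y)
    finally show "Im (cinner (x - m) y) = Im 0" by simp
  qed
  then show ?thesis using that m(1) by blast
qed


section \<open>Dimensions of complements\<close>

lemma card_le_ecdim:
  assumes "B \<subseteq> C" "complex_vector.independent B" "finite B"
  shows "enat (card B) \<le> ecdim C"
proof (cases "\<exists>F. finite F \<and> C \<subseteq> complex_vector.span F")
  case True
  then obtain F where F: "finite F" "C \<subseteq> complex_vector.span F" by blast
  obtain A where A: "A \<subseteq> C" "complex_vector.independent A" "C \<subseteq> complex_vector.span A"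
      "card A = complex_vector.dim C"
    using complex_vector.basis_exists by blast
  have "finite A"
    using complex_vector.independent_span_bound[OF F(1) A(2)] A(1) F(2) by blast
  then have "card B \<le> card A"
    using complex_vector.independent_span_bound[of A B] assms A(3) by blast
  then show ?thesis using True A(4) by (simp add: ecdim_def)
next
  case False
  then show ?thesis by (auto simp: ecdim_def)
qed

lemma ecdim_le_card:
  assumes "C \<subseteq> complex_vector.span B" "finite B"
  shows "ecdim C \<le> enat (card B)"
  using assms complex_vector.dim_le_card[OF assms] by (auto simp: ecdim_def)

lemma independent_subset_of_card:
  assumes "enat n \<le> ecdim C"
  obtains B where "B \<subseteq> C" "complex_vector.independent B" "finite B" "card B = n"
proof -
  obtain A where A: "A \<subseteq> C" "complex_vector.independent A" "C \<subseteq> complex_vector.span A"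
    using complex_vector.maximal_independent_subset by blast
  have "\<exists>B \<subseteq> A. finite B \<and> card B = n"
  proof (cases "finite A")
    case True
    then have "n \<le> card A" using ecdim_le_card[OF A(3)] assms by (metis enat_ord_simps(1) order_trans)
    then show ?thesis by (metis True obtain_subset_with_card_n)
  next
    case False
    then show ?thesis by (metis infinite_arbitrarily_large)
  qed
  then show ?thesis using that A complex_vector.independent_mono by blast
qed

lemma basis_of_finite_ecdim:
  assumes "ecdim C \<noteq> \<infinity>"
  obtains B where "B \<subseteq> C" "complex_vector.independent B" "finite B"
    "C \<subseteq> complex_vector.span B" "ecdim C = enat (card B)"
proof -
  obtain F where F: "finite F" "C \<subseteq> complex_vector.span F"
    using assms by (auto simp: ecdim_def split: if_splits)
  obtain A where A: "A \<subseteq> C" "complex_vector.independent A" "C \<subseteq> complex_vector.span A"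
      "card A = complex_vector.dim C"
    using complex_vector.basis_exists by blast
  have "finite A"
    using complex_vector.independent_span_bound[OF F(1) A(2)] A(1) F(2) by blast
  moreover have "ecdim C = enat (card A)" using F A(4) by (auto simp: ecdim_def)
  ultimately show ?thesis using that A by blast
qed

definition direct_complement :: "'a::complex_inner set \<Rightarrow> 'a set \<Rightarrow> 'a set \<Rightarrow> bool" where
  "direct_complement W C V \<longleftrightarrow>
     complex_vector.subspace W \<and> complex_vector.subspace C \<and> complex_vector.subspace V \<and>
     V = {w + c |w c. w \<in> W \<and> c \<in> C} \<and> W \<inter> C = {0}"

lemma direct_complementD:
  assumes "direct_complement W C V"
  shows "complex_vector.subspace W" "complex_vector.subspace C" "complex_vector.subspace V"
    "W \<subseteq> V" "C \<subseteq> V" "\<And>x. x \<in> W \<Longrightarrow> x \<in> C \<Longrightarrow> x = 0"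
    "\<And>v. v \<in> V \<Longrightarrow> \<exists>c\<in>C. v - c \<in> W"
proof -
  show W: "complex_vector.subspace W" and C: "complex_vector.subspace C"
    and "complex_vector.subspace V"
    using assms unfolding direct_complement_def by blast+
  show "x = 0" if "x \<in> W" "x \<in> C" for x
    using assms that by (auto simp: direct_complement_def)
  have V: "V = {w + c |w c. w \<in> W \<and> c \<in> C}"
    using assms by (auto simp: direct_complement_def)
  have "w + 0 \<in> V" if "w \<in> W" for w
    unfolding V using that complex_vector.subspace_0[OF C] by blast
  then show "W \<subseteq> V" by auto
  have "0 + c \<in> V" if "c \<in> C" for c
    unfolding V using that complex_vector.subspace_0[OF W] by blast
  then show "C \<subseteq> V" by auto
  show "\<exists>c\<in>C. v - c \<in> W" if "v \<in> V" for v
    using that unfolding V by force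
qed

text \<open>
  Bases of a quotient \<open>V / W\<close> are described by families in \<open>V\<close>, so that no type of cosets is needed.
  Families rather than sets are used so that bases of several spaces can be mapped into one space and
  joined before it is known that their images are distinct.
\<close>

definition independent_modulo :: "'a::complex_inner set \<Rightarrow> 'i set \<Rightarrow> ('i \<Rightarrow> 'a) \<Rightarrow> bool" where
  "independent_modulo W I x \<longleftrightarrow> (\<forall>c. (\<Sum>i\<in>I. c i *\<^sub>C x i) \<in> W \<longrightarrow> (\<forall>i\<in>I. c i = 0))"

definition spanning_modulo :: "'a::complex_inner set \<Rightarrow> 'a set \<Rightarrow> 'i set \<Rightarrow> ('i \<Rightarrow> 'a) \<Rightarrow> bool" where
  "spanning_modulo W V I x \<longleftrightarrow> (\<forall>v\<in>V. \<exists>c. v - (\<Sum>i\<in>I. c i *\<^sub>C x i) \<in> W)"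

text \<open>
  Each \<open>y i\<close> is the component in \<open>C\<close> of \<open>x i\<close>. It represents the same class modulo \<open>W\<close>, which moves
  questions about the quotient into \<open>C\<close>.
\<close>

lemma complement_representatives:
  assumes D: "direct_complement W C V" and x: "\<And>i. i \<in> I \<Longrightarrow> x i \<in> V"
  obtains y where "\<And>i. i \<in> I \<Longrightarrow> y i \<in> C"
    "\<And>c. (\<Sum>i\<in>I. c i *\<^sub>C x i) - (\<Sum>i\<in>I. c i *\<^sub>C y i) \<in> W"
proof -
  note D' = direct_complementD[OF D]
  have "\<forall>i\<in>I. \<exists>c\<in>C. x i - c \<in> W" using D'(7) x by blast
  then obtain y where y: "\<And>i. i \<in> I \<Longrightarrow> y i \<in> C" "\<And>i. i \<in> I \<Longrightarrow> x i - y i \<in> W" by metis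
  have "(\<Sum>i\<in>I. c i *\<^sub>C (x i - y i)) \<in> W" for c
    by (intro complex_vector.subspace_sum complex_vector.subspace_scale D'(1) y(2))
  then show ?thesis
    using that[of y] y(1) by (simp add: complex_vector.scale_right_diff_distrib sum_subtractf)
qed

lemma independent_modulo_card_le:
  assumes D: "direct_complement W C V" and I: "finite I"
    and x: "\<And>i. i \<in> I \<Longrightarrow> x i \<in> V" and ind: "independent_modulo W I x"
  shows "enat (card I) \<le> ecdim C"
proof -
  obtain y where yC: "\<And>i. i \<in> I \<Longrightarrow> y i \<in> C"
    and y: "\<And>c. (\<Sum>i\<in>I. c i *\<^sub>C x i) - (\<Sum>i\<in>I. c i *\<^sub>C y i) \<in> W"
    using complement_representatives[where x = x and I = I, OF D x] by blast
  have zero: "\<forall>i\<in>I. c i = 0" if "(\<Sum>i\<in>I. c i *\<^sub>C y i) = 0" for c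
    using y[of c] that ind by (simp add: independent_modulo_def)
  have inj: "inj_on y I"
  proof (rule inj_onI)
    fix i j assume ij: "i \<in> I" "j \<in> I" "y i = y j"
    \<comment> \<open>The combination \<open>y i - y j\<close> vanishes, so its coefficients do, which forces \<open>i = j\<close>.\<close>
    have "(\<Sum>k\<in>I. (of_bool (k = i) - of_bool (k = j)) *\<^sub>C y k)
        = (\<Sum>k\<in>I. of_bool (k = i) *\<^sub>C y k) - (\<Sum>k\<in>I. of_bool (k = j) *\<^sub>C y k)"
      by (simp add: complex_vector.scale_left_diff_distrib sum_subtractf)
    also have "\<dots> = (\<Sum>k\<in>I. if k = i then y k else 0) - (\<Sum>k\<in>I. if k = j then y k else 0)"
      by (intro arg_cong2[where f = "(-)"] sum.cong) (auto simp: scaleC_one)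
    also have "\<dots> = 0" using ij I by simp
    finally show "i = j" using zero ij by fastforce
  qed
  have "complex_vector.independent (y ` I)"
  proof (rule complex_vector.independent_if_scalars_zero)
    fix f v assume "(\<Sum>v\<in>y ` I. f v *\<^sub>C v) = 0" "v \<in> y ` I"
    then show "f v = 0" using zero[of "f \<circ> y"] by (auto simp: sum.reindex[OF inj])
  qed (use I in simp)
  then show ?thesis
    using card_le_ecdim[of "y ` I" C] yC I card_image[OF inj] by auto
qed

lemma spanning_modulo_le_card:
  assumes D: "direct_complement W C V" and I: "finite I"
    and x: "\<And>i. i \<in> I \<Longrightarrow> x i \<in> V" and span: "spanning_modulo W V I x"
  shows "ecdim C \<le> enat (card I)"
proof -
  note D' = direct_complementD[OF D]
  obtain y where yC: "\<And>i. i \<in> I \<Longrightarrow> y i \<in> C"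
    and y: "\<And>c. (\<Sum>i\<in>I. c i *\<^sub>C x i) - (\<Sum>i\<in>I. c i *\<^sub>C y i) \<in> W"
    using complement_representatives[where x = x and I = I, OF D x] by blast
  have "C \<subseteq> complex_vector.span (y ` I)"
  proof
    fix v assume v: "v \<in> C"
    then obtain c where "v - (\<Sum>i\<in>I. c i *\<^sub>C x i) \<in> W"
      using span D'(5) by (auto simp: spanning_modulo_def)
    from complex_vector.subspace_add[OF D'(1) this y[of c]]
    have "v - (\<Sum>i\<in>I. c i *\<^sub>C y i) \<in> W" by simp
    moreover have "v - (\<Sum>i\<in>I. c i *\<^sub>C y i) \<in> C"
      by (intro complex_vector.subspace_diff complex_vector.subspace_sum
          complex_vector.subspace_scale D'(2) v yC)
    ultimately have "v = (\<Sum>i\<in>I. c i *\<^sub>C y i)" using D'(6) by fastforce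
    also have "\<dots> \<in> complex_vector.span (y ` I)"
      by (intro complex_vector.span_sum complex_vector.span_scale complex_vector.span_base) auto
    finally show "v \<in> complex_vector.span (y ` I)" .
  qed
  then have "ecdim C \<le> enat (card (y ` I))" using I by (intro ecdim_le_card) auto
  also have "\<dots> \<le> enat (card I)" using card_image_le[OF I] by simp
  finally show ?thesis .
qed

lemma independent_imp_independent_modulo:
  assumes D: "direct_complement W C V" and B: "B \<subseteq> C" "complex_vector.independent B" "finite B"
  shows "independent_modulo W B (\<lambda>b. b)"
  unfolding independent_modulo_def
proof (intro allI impI ballI)
  fix c b assume W: "(\<Sum>b\<in>B. c b *\<^sub>C b) \<in> W" and b: "b \<in> B"
  have "(\<Sum>b\<in>B. c b *\<^sub>C b) \<in> C"
    by (intro complex_vector.subspace_sum complex_vector.subspace_scale direct_complementD(2)[OF D])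
      (use B in auto)
  then have "(\<Sum>b\<in>B. c b *\<^sub>C b) = 0" using W direct_complementD(6)[OF D] by blast
  then show "c b = 0" using complex_vector.independentD[OF B(2,3) order_refl] b by blast
qed

lemma span_imp_spanning_modulo:
  assumes D: "direct_complement W C V" and B: "C \<subseteq> complex_vector.span B" "finite B"
  shows "spanning_modulo W V B (\<lambda>b. b)"
  unfolding spanning_modulo_def
proof
  fix v assume "v \<in> V"
  then obtain c where c: "c \<in> C" "v - c \<in> W" using direct_complementD(7)[OF D] by blast
  then obtain r where "c = (\<Sum>b\<in>B. r b *\<^sub>C b)"
    using B by (auto simp: complex_vector.span_finite)
  then show "\<exists>r. v - (\<Sum>b\<in>B. r b *\<^sub>C b) \<in> W" using c by blast
qed

lemma ecdim_direct_sum: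
  assumes D: "direct_complement A B V"
  shows "ecdim V = ecdim A + ecdim B"
proof (cases "ecdim A = \<infinity> \<or> ecdim B = \<infinity>")
  case True
  have "ecdim S \<le> ecdim V" if S: "S \<subseteq> V" for S
  proof (cases "ecdim V = \<infinity>")
    case False
    then obtain F where F: "finite F" "V \<subseteq> complex_vector.span F" "ecdim V = enat (card F)"
      by (metis basis_of_finite_ecdim)
    then show ?thesis using ecdim_le_card[of S F] S by auto
  qed simp
  then show ?thesis using True direct_complementD(4,5)[OF D] by (metis enat_ord_simps(5) plus_enat_simps(2,3))
next
  case False
  obtain a where a: "a \<subseteq> A" "complex_vector.independent a" "finite a"
    "A \<subseteq> complex_vector.span a" "ecdim A = enat (card a)"
    using basis_of_finite_ecdim False by metis
  obtain b where b: "b \<subseteq> B" "complex_vector.independent b" "finite b"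
    "B \<subseteq> complex_vector.span b" "ecdim B = enat (card b)"
    using basis_of_finite_ecdim False by metis
  note D' = direct_complementD[OF D]
  have "0 \<notin> a" using a(2) complex_vector.dependent_zero by blast
  then have disj: "a \<inter> b = {}" using a(1) b(1) D'(6) by (metis disjoint_iff subsetD)
  have "complex_vector.independent (a \<union> b)"
  proof (rule complex_vector.independent_if_scalars_zero)
    fix f x assume "(\<Sum>x\<in>a \<union> b. f x *\<^sub>C x) = 0" and x: "x \<in> a \<union> b"
    then have s: "(\<Sum>x\<in>a. f x *\<^sub>C x) = - (\<Sum>x\<in>b. f x *\<^sub>C x)"
      by (simp add: sum.union_disjoint[OF a(3) b(3) disj] eq_neg_iff_add_eq_0)
    have sA: "(\<Sum>x\<in>a. f x *\<^sub>C x) \<in> A"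
      by (intro complex_vector.subspace_sum complex_vector.subspace_scale D'(1)) (use a in auto)
    have sB: "(\<Sum>x\<in>b. f x *\<^sub>C x) \<in> B"
      by (intro complex_vector.subspace_sum complex_vector.subspace_scale D'(2)) (use b in auto)
    have "(\<Sum>x\<in>a. f x *\<^sub>C x) \<in> B"
      using complex_vector.subspace_neg[OF D'(2) sB] s by simp
    then have "(\<Sum>x\<in>a. f x *\<^sub>C x) = 0" using D'(6) sA by blast
    moreover from this s have "(\<Sum>x\<in>b. f x *\<^sub>C x) = 0" by simp
    ultimately show "f x = 0"
      using x complex_vector.independentD[OF a(2,3) order_refl]
        complex_vector.independentD[OF b(2,3) order_refl] by blast
  qed (use a b in simp)
  then have "enat (card (a \<union> b)) \<le> ecdim V"
    using card_le_ecdim a(1,3) b(1,3) D'(4,5) by (metis Un_subset_iff finite_UnI order_trans)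
  moreover have "V \<subseteq> complex_vector.span (a \<union> b)"
  proof -
    have "A \<subseteq> complex_vector.span (a \<union> b)" "B \<subseteq> complex_vector.span (a \<union> b)"
      using a(4) b(4) complex_vector.span_mono[of a "a \<union> b"] complex_vector.span_mono[of b "a \<union> b"]
      by auto
    then show ?thesis using D by (auto simp: direct_complement_def intro!: complex_vector.span_add)
  qed
  then have "ecdim V \<le> enat (card (a \<union> b))" using a b by (intro ecdim_le_card) auto
  ultimately show ?thesis
    using a(3,5) b(3,5) by (simp add: card_Un_disjoint disj)
qed

section \<open>Adjoints and von Neumann's decomposition\<close>

text \<open>
  The definite description in the adjoint is legitimate because density of the domain makes the
  representing vector unique. From here on the adjoint is handled as a relation.
\<close>

lemma adjoint_operator_eq_Some_iff:
  assumes "densely_defined A"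
  shows "adjoint_operator A g = Some h \<longleftrightarrow> (\<forall>f\<in>dom A. cinner g (the (A f)) = cinner h f)"
proof -
  have uniq: "h = h'" if "\<forall>f\<in>dom A. cinner g (the (A f)) = cinner h f"
    "\<forall>f\<in>dom A. cinner g (the (A f)) = cinner h' f" for h h'
    using cinner_dense_imp_zero[of "dom A" "h - h'"] assms that
    by (simp add: densely_defined_def cinner_diff_left)
  show ?thesis
  proof
    assume "adjoint_operator A g = Some h"
    then have ex: "\<exists>h. \<forall>f\<in>dom A. cinner g (the (A f)) = cinner h f"
      and h: "(THE h. \<forall>f\<in>dom A. cinner g (the (A f)) = cinner h f) = h"
      by (auto simp: adjoint_operator_def split: if_splits)
    have "\<exists>!h. \<forall>f\<in>dom A. cinner g (the (A f)) = cinner h f" using ex uniq by blast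
    from theI'[OF this] show "\<forall>f\<in>dom A. cinner g (the (A f)) = cinner h f" unfolding h .
  next
    assume h: "\<forall>f\<in>dom A. cinner g (the (A f)) = cinner h f"
    then have "(THE h. \<forall>f\<in>dom A. cinner g (the (A f)) = cinner h f) = h"
      using uniq by (intro the_equality) auto
    then show "adjoint_operator A g = Some h" using h by (auto simp: adjoint_operator_def)
  qed
qed

lemma adjoint_operator_add:
  assumes "densely_defined A" "adjoint_operator A g = Some h" "adjoint_operator A g' = Some h'"
  shows "adjoint_operator A (g + g') = Some (h + h')"
  using assms(2,3) by (simp add: adjoint_operator_eq_Some_iff[OF assms(1)] cinner_add_left)

lemma adjoint_operator_scaleC:
  assumes "densely_defined A" "adjoint_operator A g = Some h"
  shows "adjoint_operator A (c *\<^sub>C g) = Some (c *\<^sub>C h)"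
  using assms(2) by (simp add: adjoint_operator_eq_Some_iff[OF assms(1)] cinner_scaleC_left)

lemma adjoint_operator_diff:
  assumes "densely_defined A" "adjoint_operator A g = Some h" "adjoint_operator A g' = Some h'"
  shows "adjoint_operator A (g - g') = Some (h - h')"
  using assms(2,3) by (simp add: adjoint_operator_eq_Some_iff[OF assms(1)] cinner_diff_left)

lemma adjoint_operator_zero:
  assumes "densely_defined A"
  shows "adjoint_operator A 0 = Some 0"
  using adjoint_operator_eq_Some_iff[OF assms, of 0 0]
  by (metis cinner_diff_left cancel_comm_monoid_add_class.diff_cancel)

lemma subspace_dom_adjoint:
  assumes "densely_defined A"
  shows "complex_vector.subspace (dom (adjoint_operator A))"
  using adjoint_operator_add[OF assms] adjoint_operator_scaleC[OF assms] adjoint_operator_zero[OF assms]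
  by (auto simp: complex_vector.subspace_def dom_def)

abbreviation deficiency_space :: "('a::complex_inner \<rightharpoonup> 'a) \<Rightarrow> complex \<Rightarrow> 'a set" where
  "deficiency_space A z \<equiv> ker_operator (minus_scalar (adjoint_operator A) z)"

lemma mem_deficiency_space:
  "x \<in> deficiency_space A z \<longleftrightarrow> adjoint_operator A x = Some (z *\<^sub>C x)"
  by (auto simp: ker_operator_def minus_scalar_def)

lemma subspace_deficiency_space:
  assumes "densely_defined A"
  shows "complex_vector.subspace (deficiency_space A z)"
  unfolding complex_vector.subspace_def
  using adjoint_operator_add[OF assms] adjoint_operator_scaleC[OF assms] adjoint_operator_zero[OF assms]
  by (auto simp: mem_deficiency_space scaleC_add_right scaleC_scaleC mult.commute)

lemma symmetric_operatorD:
  assumes "symmetric_operator A"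
  shows "densely_defined A" "complex_vector.subspace (dom A)"
    "\<And>f. f \<in> dom A \<Longrightarrow> adjoint_operator A f = Some (the (A f))"
    "\<And>f g. f \<in> dom A \<Longrightarrow> g \<in> dom A \<Longrightarrow> the (A (f + g)) = the (A f) + the (A g)"
    "\<And>c f. f \<in> dom A \<Longrightarrow> the (A (c *\<^sub>C f)) = c *\<^sub>C the (A f)"
    "dom A \<subseteq> dom (adjoint_operator A)"
  using assms
  by (auto simp: symmetric_operator_def linear_operator_def map_le_def dom_def) 

lemma symmetric_operator_diff:
  assumes "symmetric_operator A" "f \<in> dom A" "g \<in> dom A"
  shows "the (A (f - g)) = the (A f) - the (A g)"
proof -
  note A = symmetric_operatorD[OF assms(1)]
  have "f - g \<in> dom A" using complex_vector.subspace_diff[OF A(2)] assms by blast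
  from A(4)[OF this assms(3)] show ?thesis by (simp add: algebra_simps)
qed

text \<open>
  Symmetry cancels the cross terms. The identity makes \<open>A + i\<close> injective and bounded below,
  hence its range closed when \<open>A\<close> is closed.
\<close>

lemma norm_plus_i:
  assumes A: "symmetric_operator A" and f: "f \<in> dom A"
  shows "(norm (the (A f) + \<i> *\<^sub>C f))\<^sup>2 = (norm (the (A f)))\<^sup>2 + (norm f)\<^sup>2"
proof -
  let ?g = "the (A f)"
  have "cinner f ?g = cinner ?g f"
    using symmetric_operatorD(3)[OF A f] f
    by (simp add: adjoint_operator_eq_Some_iff[OF symmetric_operatorD(1)[OF A]])
  then have "complex_of_real ((norm (?g + \<i> *\<^sub>C f))\<^sup>2) = complex_of_real ((norm ?g)\<^sup>2 + (norm f)\<^sup>2)"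
    unfolding norm_eq_sqrt_cinner of_real_add
    by (simp add: cinner_add_left cinner_add_right cinner_scaleC_left cinner_scaleC_right algebra_simps)
  then show ?thesis by (simp only: of_real_eq_iff)
qed

lemma closed_operator_limit:
  assumes cl: "closed_operator A" and f: "\<And>n. f n \<in> dom A"
    and g: "f \<longlonglongrightarrow> g" and h: "(\<lambda>n. the (A (f n))) \<longlonglongrightarrow> h"
  shows "A g = Some h"
proof -
  have "(\<lambda>n. (f n, the (A (f n)))) \<longlonglongrightarrow> (g, h)" by (rule tendsto_Pair[OF g h])
  moreover have "(f n, the (A (f n))) \<in> Map.graph A" for n
    using f[of n] by (auto simp: Map.graph_def)
  ultimately have "(g, h) \<in> Map.graph A"
    using closed_sequentially[of "Map.graph A" "\<lambda>n. (f n, the (A (f n)))"] cl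
    by (simp add: closed_operator_def)
  then show ?thesis by (simp add: Map.graph_def)
qed

text \<open>
  If \<open>A f\<^sub>n + i f\<^sub>n\<close> converges, \<open>norm_plus_i\<close> makes \<open>f\<^sub>n\<close> and \<open>A f\<^sub>n\<close> separately Cauchy, and
  closedness of the graph identifies their limits.
\<close>

lemma closed_range_plus_i:
  fixes A :: "'a::chilbert_space \<rightharpoonup> 'a"
  assumes A: "symmetric_operator A" and cl: "closed_operator A"
  shows "closed ((\<lambda>f. the (A f) + \<i> *\<^sub>C f) ` dom A)"
  unfolding closed_sequential_limits
proof (intro allI impI, elim conjE)
  fix y l assume "\<forall>n. y n \<in> (\<lambda>f. the (A f) + \<i> *\<^sub>C f) ` dom A" and l: "y \<longlonglongrightarrow> l"
  then have "\<forall>n. \<exists>f. f \<in> dom A \<and> y n = the (A f) + \<i> *\<^sub>C f" by blast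
  from choice[OF this] obtain f
    where f: "f n \<in> dom A" and y: "y n = the (A (f n)) + \<i> *\<^sub>C f n" for n by blast
  note A' = symmetric_operatorD[OF A]
  have bound: "norm (the (A (f m)) - the (A (f n))) \<le> norm (y m - y n) \<and>
      norm (f m - f n) \<le> norm (y m - y n)" for m n
  proof -
    have d: "f m - f n \<in> dom A" using complex_vector.subspace_diff[OF A'(2)] f by blast
    have "y m - y n = the (A (f m - f n)) + \<i> *\<^sub>C (f m - f n)"
      by (simp add: y symmetric_operator_diff[OF A] f complex_vector.scale_right_diff_distrib)
    then have "(norm (y m - y n))\<^sup>2 = (norm (the (A (f m)) - the (A (f n))))\<^sup>2 + (norm (f m - f n))\<^sup>2"
      using norm_plus_i[OF A d] by (simp add: symmetric_operator_diff[OF A] f)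
    then have "(norm (the (A (f m)) - the (A (f n))))\<^sup>2 \<le> (norm (y m - y n))\<^sup>2"
      "(norm (f m - f n))\<^sup>2 \<le> (norm (y m - y n))\<^sup>2" by simp_all
    then show ?thesis by (meson norm_ge_zero power2_le_imp_le)
  qed
  have "Cauchy y" using l by (rule LIMSEQ_imp_Cauchy)
  then have "Cauchy f" "Cauchy (\<lambda>n. the (A (f n)))"
    using bound unfolding Cauchy_iff by (meson le_less_trans)+
  then obtain g h where g: "f \<longlonglongrightarrow> g" and h: "(\<lambda>n. the (A (f n))) \<longlonglongrightarrow> h"
    using Cauchy_convergent convergent_def by metis
  from closed_operator_limit[OF cl f g h] have Ag: "A g = Some h" .
  have "(\<lambda>n. the (A (f n)) + \<i> *\<^sub>C f n) \<longlonglongrightarrow> h + \<i> *\<^sub>C g" by (intro tendsto_intros tendsto_scaleC g h)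
  then have "l = h + \<i> *\<^sub>C g" using l LIMSEQ_unique unfolding y[symmetric] by blast
  then show "l \<in> (\<lambda>f. the (A f) + \<i> *\<^sub>C f) ` dom A" using Ag by force
qed

text \<open>
  The orthogonal complement of the range of \<open>A + i\<close> is \<open>ker (A\<^sup>* - i)\<close>. Hence
  \<open>(A\<^sup>* + i) g = (A + i) f + h\<close> for some \<open>f \<in> dom A\<close> and \<open>h \<in> ker (A\<^sup>* - i)\<close>; since
  \<open>(A\<^sup>* + i) h = 2 i h\<close>, the vector \<open>g - f - h / (2 i)\<close> is annihilated by \<open>A\<^sup>* + i\<close>.
\<close>

lemma von_neumann_span:
  fixes A :: "'a::chilbert_space \<rightharpoonup> 'a"
  assumes A: "symmetric_operator A" and cl: "closed_operator A"
    and g: "g \<in> dom (adjoint_operator A)"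
  obtains f x y where "f \<in> dom A" "x \<in> deficiency_space A \<i>" "y \<in> deficiency_space A (- \<i>)"
    "g = f + (x + y)"
proof -
  note A' = symmetric_operatorD[OF A]
  let ?R = "(\<lambda>f. the (A f) + \<i> *\<^sub>C f) ` dom A"
  obtain k where k: "adjoint_operator A g = Some k" using g by blast
  have "complex_vector.subspace ?R"
    unfolding complex_vector.subspace_def
  proof (intro conjI ballI allI)
    have "the (A 0) = 0" using A'(5)[of 0 0] complex_vector.subspace_0[OF A'(2)] by simp
    then show "0 \<in> ?R" using complex_vector.subspace_0[OF A'(2)] by force
  next
    fix u v assume "u \<in> ?R" "v \<in> ?R"
    then obtain a b where ab: "a \<in> dom A" "b \<in> dom A"
      "u = the (A a) + \<i> *\<^sub>C a" "v = the (A b) + \<i> *\<^sub>C b" by blast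
    then have "u + v = the (A (a + b)) + \<i> *\<^sub>C (a + b)" by (simp add: A'(4) scaleC_add_right)
    then show "u + v \<in> ?R" using complex_vector.subspace_add[OF A'(2) ab(1,2)] by blast
  next
    fix c u assume "u \<in> ?R"
    then obtain a where a: "a \<in> dom A" "u = the (A a) + \<i> *\<^sub>C a" by blast
    then have "c *\<^sub>C u = the (A (c *\<^sub>C a)) + \<i> *\<^sub>C (c *\<^sub>C a)"
      by (simp add: A'(5) scaleC_add_right scaleC_scaleC mult.commute)
    then show "c *\<^sub>C u \<in> ?R" using complex_vector.subspace_scale[OF A'(2) a(1)] by blast
  qed
  then obtain r where r: "r \<in> ?R"
    "\<And>v. v \<in> ?R \<Longrightarrow> cinner (k + \<i> *\<^sub>C g - r) v = 0"
    using orthogonal_decomposition[OF closed_range_plus_i[OF A cl]] by metis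
  define h where "h = k + \<i> *\<^sub>C g - r"
  obtain f where f: "f \<in> dom A" "r = the (A f) + \<i> *\<^sub>C f" using r(1) by blast
  have h: "adjoint_operator A h = Some (\<i> *\<^sub>C h)"
    unfolding adjoint_operator_eq_Some_iff[OF A'(1)]
  proof
    fix u assume u: "u \<in> dom A"
    have "cinner h (the (A u)) + \<i> * cinner h u = 0"
      using r(2)[of "the (A u) + \<i> *\<^sub>C u"] u
      by (simp add: h_def cinner_add_right cinner_scaleC_right)
    then show "cinner h (the (A u)) = cinner (\<i> *\<^sub>C h) u"
      by (simp add: cinner_scaleC_left eq_neg_iff_add_eq_0)
  qed
  define x where "x = (1 / (2 * \<i>)) *\<^sub>C h"
  have x: "adjoint_operator A x = Some (\<i> *\<^sub>C x)"
    using adjoint_operator_scaleC[OF A'(1) h, of "1 / (2 * \<i>)"]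
    by (simp add: x_def scaleC_scaleC mult.commute)
  have "adjoint_operator A (g - f - x) = Some (k - the (A f) - \<i> *\<^sub>C x)"
    by (intro adjoint_operator_diff A'(1) A'(3) k f x)
  moreover have "k - the (A f) - \<i> *\<^sub>C x = (- \<i>) *\<^sub>C (g - f - x)"
  proof -
    have "\<i> *\<^sub>C x + \<i> *\<^sub>C x = h"
      unfolding x_def scaleC_scaleC scaleC_add_left[symmetric] by (simp add: scaleC_one)
    then show ?thesis
      unfolding h_def f(2)
      by (simp add: complex_vector.scale_right_diff_distrib algebra_simps)
  qed
  ultimately have "g - f - x \<in> deficiency_space A (- \<i>)" by (simp add: mem_deficiency_space)
  then show ?thesis using that[of f x "g - f - x"] f(1) x by (simp add: mem_deficiency_space)
qed

text \<open>
  Applying \<open>A\<^sup>* + i\<close> to the relation leaves \<open>(A + i) f + 2 i x = 0\<close>. The first summand is in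
  the range of \<open>A + i\<close>, to which \<open>x \<in> ker (A\<^sup>* - i)\<close> is orthogonal, so both summands vanish.
\<close>

lemma von_neumann_zero:
  assumes A: "symmetric_operator A" and f: "f \<in> dom A" and x: "x \<in> deficiency_space A \<i>"
    and y: "y \<in> deficiency_space A (- \<i>)" and sum: "f + (x + y) = 0"
  shows "f = 0 \<and> x = 0 \<and> y = 0"
proof -
  note A' = symmetric_operatorD[OF A]
  have x': "adjoint_operator A x = Some (\<i> *\<^sub>C x)" and y': "adjoint_operator A y = Some ((- \<i>) *\<^sub>C y)"
    using x[unfolded mem_deficiency_space] y[unfolded mem_deficiency_space] .
  have "adjoint_operator A (f + (x + y)) = Some (the (A f) + (\<i> *\<^sub>C x + (- \<i>) *\<^sub>C y))"
    by (rule adjoint_operator_add[OF A'(1) A'(3)[OF f] adjoint_operator_add[OF A'(1) x' y']])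
  then have "the (A f) + (\<i> *\<^sub>C x + (- \<i>) *\<^sub>C y) = 0"
    unfolding sum adjoint_operator_zero[OF A'(1)] by simp
  moreover have "\<i> *\<^sub>C f + (\<i> *\<^sub>C x + \<i> *\<^sub>C y) = 0"
    using arg_cong[OF sum, of "(*\<^sub>C) \<i>"] by (simp add: scaleC_add_right)
  ultimately have "the (A f) + (\<i> *\<^sub>C x + (- \<i>) *\<^sub>C y) + (\<i> *\<^sub>C f + (\<i> *\<^sub>C x + \<i> *\<^sub>C y)) = 0"
    by simp
  then have *: "(the (A f) + \<i> *\<^sub>C f) + (2 * \<i>) *\<^sub>C x = 0"
    unfolding mult_2 scaleC_add_left by (simp add: algebra_simps)
  have "cinner x (the (A f)) = cinner (\<i> *\<^sub>C x) f"
    using x' f by (simp add: adjoint_operator_eq_Some_iff[OF A'(1)])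
  then have "cinner x (the (A f) + \<i> *\<^sub>C f) = 0"
    by (simp add: cinner_add_right cinner_scaleC_left cinner_scaleC_right)
  moreover have "cinner x ((the (A f) + \<i> *\<^sub>C f) + (2 * \<i>) *\<^sub>C x) = cinner x 0"
    unfolding * ..
  ultimately have "2 * \<i> * cinner x x = cinner x 0"
    by (simp only: cinner_add_right cinner_scaleC_right add_0)
  moreover have "cinner x 0 = 0" using cinner_diff_right[of x x x] by simp
  ultimately have "x = 0" by (simp add: cinner_same)
  then have "the (A f) + \<i> *\<^sub>C f = 0" using * by simp
  then have "(norm (the (A f)))\<^sup>2 + (norm f)\<^sup>2 = 0" using norm_plus_i[OF A f] by simp
  then have "f = 0" by (simp add: add_nonneg_eq_0_iff)
  then show ?thesis using \<open>x = 0\<close> sum by simp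
qed

definition deficiency_sum :: "('a::complex_inner \<rightharpoonup> 'a) \<Rightarrow> 'a set" where
  "deficiency_sum A = {x + y |x y. x \<in> deficiency_space A \<i> \<and> y \<in> deficiency_space A (- \<i>)}"

lemma von_neumann_decomposition:
  fixes A :: "'a::chilbert_space \<rightharpoonup> 'a"
  assumes A: "symmetric_operator A" "closed_operator A"
  shows "direct_complement (dom A) (deficiency_sum A) (dom (adjoint_operator A))"
    and "direct_complement (deficiency_space A \<i>) (deficiency_space A (- \<i>)) (deficiency_sum A)"
proof -
  note A' = symmetric_operatorD[OF A(1)]
  note N = subspace_deficiency_space[OF A'(1)]
  have C: "complex_vector.subspace (deficiency_sum A)"
    unfolding deficiency_sum_def by (rule complex_vector.subspace_sums[OF N N])
  have zero: "0 \<in> dom A" "0 \<in> deficiency_space A \<i>" "0 \<in> deficiency_space A (- \<i>)"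
    by (intro complex_vector.subspace_0 A'(2) N)+
  have CV: "deficiency_sum A \<subseteq> dom (adjoint_operator A)"
  proof
    fix v assume "v \<in> deficiency_sum A"
    then obtain x y where "x \<in> dom (adjoint_operator A)" "y \<in> dom (adjoint_operator A)" "v = x + y"
      unfolding deficiency_sum_def mem_deficiency_space by blast
    then show "v \<in> dom (adjoint_operator A)"
      using complex_vector.subspace_add[OF subspace_dom_adjoint[OF A'(1)]] by blast
  qed
  have 1: "dom (adjoint_operator A) \<subseteq> {f + c |f c. f \<in> dom A \<and> c \<in> deficiency_sum A}"
  proof
    fix g assume "g \<in> dom (adjoint_operator A)"
    from von_neumann_span[OF A this] obtain f x y where
      "f \<in> dom A" "x \<in> deficiency_space A \<i>" "y \<in> deficiency_space A (- \<i>)" "g = f + (x + y)" .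
    then show "g \<in> {f + c |f c. f \<in> dom A \<and> c \<in> deficiency_sum A}"
      unfolding deficiency_sum_def by blast
  qed
  have 2: "{f + c |f c. f \<in> dom A \<and> c \<in> deficiency_sum A} \<subseteq> dom (adjoint_operator A)"
    using complex_vector.subspace_add[OF subspace_dom_adjoint[OF A'(1)]] A'(6) CV by blast
  have 3: "v = 0" if v: "v \<in> dom A" "v \<in> deficiency_sum A" for v
  proof -
    obtain x y where xy: "x \<in> deficiency_space A \<i>" "y \<in> deficiency_space A (- \<i>)" "v = x + y"
      using v(2) unfolding deficiency_sum_def by blast
    have "- v \<in> dom A" using complex_vector.subspace_neg[OF A'(2) v(1)] .
    from von_neumann_zero[OF A(1) this xy(1,2)] show ?thesis using xy(3) by simp
  qed
  show "direct_complement (dom A) (deficiency_sum A) (dom (adjoint_operator A))"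
    unfolding direct_complement_def
    using A'(2) C subspace_dom_adjoint[OF A'(1)] 1 2 3 zero(1) complex_vector.subspace_0[OF C] by blast
  have "v = 0" if v: "v \<in> deficiency_space A \<i>" "v \<in> deficiency_space A (- \<i>)" for v
    using von_neumann_zero[OF A(1) zero(1) v(1) complex_vector.subspace_neg[OF N v(2)]] by simp
  then show "direct_complement (deficiency_space A \<i>) (deficiency_space A (- \<i>)) (deficiency_sum A)"
    unfolding direct_complement_def using N C zero(2,3) deficiency_sum_def[of A] by blast
qed

text \<open>
  The defect is half the codimension of \<open>dom A\<close> in \<open>dom A\<^sup>*\<close>: by the decomposition above, the sum of
  the two deficiency spaces is a complement of \<open>dom A\<close> in \<open>dom A\<^sup>*\<close>.
\<close>

lemma defect_eq_ecdim:
  fixes A :: "'a::chilbert_space \<rightharpoonup> 'a"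
  assumes A: "symmetric_operator A" "closed_operator A"
  shows "defect A = ennreal_of_enat (ecdim (deficiency_sum A)) / 2"
  by (simp add: defect_def deficiency_plus_def deficiency_minus_def
      ecdim_direct_sum[OF von_neumann_decomposition(2)[OF A]])

section \<open>Splitting a quotient space\<close>

text \<open>
  The maps \<open>P j\<close> act in both directions between \<open>V\<close> and \<open>Vj j\<close>. Modulo \<open>W\<close> and \<open>Wj j\<close> they embed
  \<open>V / W\<close> into the product of the quotients \<open>Vj j / Wj j\<close> (\<open>P_W\<close>, \<open>P_separates\<close>), and they also
  provide preimages of the direct sum (\<open>P_same\<close>, \<open>P_other\<close>). The dimensions of the quotients
  are measured on the complements \<open>C\<close> and \<open>Cj j\<close>.
\<close>

locale quotient_splitting =
  fixes J :: "'j set" and V W C :: "'a::complex_inner set"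
    and Vj Wj Cj :: "'j \<Rightarrow> 'a set" and P :: "'j \<Rightarrow> 'a \<Rightarrow> 'a"
  assumes compl: "direct_complement W C V"
    and complj: "j \<in> J \<Longrightarrow> direct_complement (Wj j) (Cj j) (Vj j)"
    and P_add: "j \<in> J \<Longrightarrow> P j (x + y) = P j x + P j y"
    and P_scale: "j \<in> J \<Longrightarrow> P j (c *\<^sub>C x) = c *\<^sub>C P j x"
    and P_V: "j \<in> J \<Longrightarrow> v \<in> V \<Longrightarrow> P j v \<in> Vj j"
    and P_W: "j \<in> J \<Longrightarrow> w \<in> W \<Longrightarrow> P j w \<in> Wj j"
    and P_Vj: "j \<in> J \<Longrightarrow> v \<in> Vj j \<Longrightarrow> P j v \<in> V"
    and P_same: "j \<in> J \<Longrightarrow> v \<in> Vj j \<Longrightarrow> P j (P j v) - v \<in> Wj j"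
    and P_other: "j \<in> J \<Longrightarrow> k \<in> J \<Longrightarrow> j \<noteq> k \<Longrightarrow> v \<in> Vj j \<Longrightarrow> P k (P j v) \<in> Wj k"
    and P_separates: "v \<in> V \<Longrightarrow> (\<And>j. j \<in> J \<Longrightarrow> P j v \<in> Wj j) \<Longrightarrow> v \<in> W"
begin

lemma P_sum: "j \<in> J \<Longrightarrow> P j (\<Sum>i\<in>I. f i) = (\<Sum>i\<in>I. P j (f i))"
  using P_scale[of j 0 0] by (induction I rule: infinite_finite_induct) (simp_all add: P_add)

lemma P_diff: "j \<in> J \<Longrightarrow> P j (x - y) = P j x - P j y"
  by (metis P_add add_diff_cancel diff_add_cancel)

text \<open>
  The vector \<open>\<Sum>j\<in>F. P j (u j)\<close> is a preimage of the family \<open>u\<close>, extended by zero outside \<open>F\<close>.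
\<close>

lemma component_of_sum:
  assumes F: "finite F" "F \<subseteq> J" and u: "\<And>j. j \<in> F \<Longrightarrow> u j \<in> Vj j" and k: "k \<in> J"
  shows "P k (\<Sum>j\<in>F. P j (u j)) - (if k \<in> F then u k else 0) \<in> Wj k"
proof -
  have "P k (\<Sum>j\<in>F. P j (u j)) - (if k \<in> F then u k else 0)
      = (\<Sum>j\<in>F. P k (P j (u j)) - (if j = k then u j else 0))"
    using F(1) by (auto simp: P_sum[OF k] sum_subtractf)
  also have "\<dots> \<in> Wj k"
  proof (rule complex_vector.subspace_sum)
    show "complex_vector.subspace (Wj k)" using complj[OF k] by (rule direct_complementD)
    show "P k (P j (u j)) - (if j = k then u j else 0) \<in> Wj k" if "j \<in> F" for j
      using that F(2) u P_same P_other k by (cases "j = k") auto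
  qed
  finally show ?thesis .
qed

text \<open>
  A relation modulo \<open>W\<close> between the vectors \<open>P j b\<close> is turned by \<open>P k\<close> into a relation modulo \<open>Wj k\<close>
  between the members of \<open>B k\<close> alone.
\<close>

lemma independent_modulo_Sigma:
  assumes F: "finite F" "F \<subseteq> J" and B: "\<And>j. j \<in> F \<Longrightarrow> finite (B j)"
    and BV: "\<And>j. j \<in> F \<Longrightarrow> B j \<subseteq> Vj j"
    and ind: "\<And>j. j \<in> F \<Longrightarrow> independent_modulo (Wj j) (B j) (\<lambda>b. b)"
  shows "independent_modulo W (Sigma F B) (\<lambda>(j, b). P j b)"
  unfolding independent_modulo_def
proof (intro allI impI)
  fix c assume W: "(\<Sum>i\<in>Sigma F B. c i *\<^sub>C (case i of (j, b) \<Rightarrow> P j b)) \<in> W"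
  define u where "u j = (\<Sum>b\<in>B j. c (j, b) *\<^sub>C b)" for j
  have "(\<Sum>i\<in>Sigma F B. c i *\<^sub>C (case i of (j, b) \<Rightarrow> P j b))
      = (\<Sum>j\<in>F. \<Sum>b\<in>B j. c (j, b) *\<^sub>C P j b)"
    using F B by (subst sum.Sigma) (auto intro!: sum.cong)
  also have "\<dots> = (\<Sum>j\<in>F. P j (u j))"
    using F(2) by (intro sum.cong) (auto simp: u_def P_sum P_scale)
  finally have W': "(\<Sum>j\<in>F. P j (u j)) \<in> W" using W by simp
  have uV: "u j \<in> Vj j" if "j \<in> F" for j
    unfolding u_def
    by (intro complex_vector.subspace_sum complex_vector.subspace_scale
        direct_complementD(3)[OF complj]) (use that F(2) BV in auto)
  have uW: "u k \<in> Wj k" if k: "k \<in> F" for k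
  proof -
    have "k \<in> J" using k F(2) by blast
    then show ?thesis
      using component_of_sum[OF F uV \<open>k \<in> J\<close>] P_W[OF _ W', of k] k
        complex_vector.subspace_diff[OF direct_complementD(1)[OF complj[OF \<open>k \<in> J\<close>]]]
      by fastforce
  qed
  then have "\<forall>b\<in>B k. c (k, b) = 0" if "k \<in> F" for k
    using ind[OF that, unfolded independent_modulo_def, THEN spec[where x = "\<lambda>b. c (k, b)"]]
      uW[OF that] by (simp add: u_def)
  then show "\<forall>i\<in>Sigma F B. c i = 0" by auto
qed

text \<open>
  Expand every component \<open>P j v\<close> modulo \<open>Wj j\<close> and subtract the corresponding preimages from \<open>v\<close>. All
  components of the difference are trivial, so it lies in \<open>W\<close> by \<open>P_separates\<close>.
\<close>

lemma spanning_modulo_Sigma: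
  assumes F: "finite F" "F \<subseteq> J" and B: "\<And>j. j \<in> F \<Longrightarrow> finite (B j)"
    and BV: "\<And>j. j \<in> F \<Longrightarrow> B j \<subseteq> Vj j"
    and span: "\<And>j. j \<in> F \<Longrightarrow> spanning_modulo (Wj j) (Vj j) (B j) (\<lambda>b. b)"
    and triv: "\<And>j. j \<in> J - F \<Longrightarrow> Vj j \<subseteq> Wj j"
  shows "spanning_modulo W V (Sigma F B) (\<lambda>(j, b). P j b)"
  unfolding spanning_modulo_def
proof
  fix v assume v: "v \<in> V"
  have "\<forall>j\<in>F. \<exists>c. P j v - (\<Sum>b\<in>B j. c b *\<^sub>C b) \<in> Wj j"
    using span v P_V F(2) unfolding spanning_modulo_def by blast
  then obtain c where c: "\<And>j. j \<in> F \<Longrightarrow> P j v - (\<Sum>b\<in>B j. c j b *\<^sub>C b) \<in> Wj j" by metis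
  define u where "u j = (\<Sum>b\<in>B j. c j b *\<^sub>C b)" for j
  have uV: "u j \<in> Vj j" if "j \<in> F" for j
    unfolding u_def
    by (intro complex_vector.subspace_sum complex_vector.subspace_scale
        direct_complementD(3)[OF complj]) (use that F(2) BV in auto)
  have sumV: "(\<Sum>j\<in>F. P j (u j)) \<in> V"
    by (intro complex_vector.subspace_sum direct_complementD(3)[OF compl] P_Vj uV) (use F in auto)
  have "v - (\<Sum>j\<in>F. P j (u j)) \<in> W"
  proof (rule P_separates)
    show "v - (\<Sum>j\<in>F. P j (u j)) \<in> V"
      by (intro complex_vector.subspace_diff direct_complementD(3)[OF compl] v sumV)
    fix k assume k: "k \<in> J"
    have "P k v - (if k \<in> F then u k else 0) \<in> Wj k"
      using c[of k] triv[of k] P_V[OF k v] k by (auto simp: u_def)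
    from complex_vector.subspace_diff[OF direct_complementD(1)[OF complj[OF k]] this
        component_of_sum[OF F uV k]]
    show "P k (v - (\<Sum>j\<in>F. P j (u j))) \<in> Wj k" by (simp add: P_diff[OF k])
  qed
  also have "(\<Sum>j\<in>F. P j (u j)) = (\<Sum>j\<in>F. \<Sum>b\<in>B j. c j b *\<^sub>C P j b)"
    using F(2) by (intro sum.cong) (auto simp: u_def P_sum P_scale)
  also have "\<dots> = (\<Sum>i\<in>Sigma F B. (case i of (j, b) \<Rightarrow> c j b) *\<^sub>C (case i of (j, b) \<Rightarrow> P j b))"
    using F B by (subst sum.Sigma) (auto intro!: sum.cong)
  finally show "\<exists>c. v - (\<Sum>i\<in>Sigma F B. c i *\<^sub>C (case i of (j, b) \<Rightarrow> P j b)) \<in> W" by blast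
qed

text \<open>
  The lower bound is stated with arbitrary \<open>n j\<close> below the dimensions so that it also covers
  infinite-dimensional components.
\<close>

lemma sum_le_ecdim:
  assumes F: "finite F" "F \<subseteq> J" and n: "\<And>j. j \<in> F \<Longrightarrow> enat (n j) \<le> ecdim (Cj j)"
  shows "enat (\<Sum>j\<in>F. n j) \<le> ecdim C"
proof -
  have "\<forall>j\<in>F. \<exists>B \<subseteq> Cj j. complex_vector.independent B \<and> finite B \<and> card B = n j"
    using n independent_subset_of_card by metis
  then obtain B where B: "\<And>j. j \<in> F \<Longrightarrow> B j \<subseteq> Cj j"
    "\<And>j. j \<in> F \<Longrightarrow> complex_vector.independent (B j)" "\<And>j. j \<in> F \<Longrightarrow> finite (B j)"
    "\<And>j. j \<in> F \<Longrightarrow> card (B j) = n j" by metis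
  have BV: "B j \<subseteq> Vj j" if "j \<in> F" for j
    using B(1)[OF that] direct_complementD(5)[OF complj, of j] that F(2) by blast
  have "independent_modulo W (Sigma F B) (\<lambda>(j, b). P j b)"
    using F B BV by (intro independent_modulo_Sigma independent_imp_independent_modulo[OF complj]) auto
  then have "enat (card (Sigma F B)) \<le> ecdim C"
    using F B BV by (intro independent_modulo_card_le[OF compl]) (auto intro!: P_Vj subsetD[OF BV])
  then show ?thesis using F B(3,4) by simp
qed

lemma ecdim_le_sum:
  assumes F: "finite F" "F \<subseteq> J" and triv: "\<And>j. j \<in> J - F \<Longrightarrow> ecdim (Cj j) = 0"
  shows "ecdim C \<le> (\<Sum>j\<in>F. ecdim (Cj j))"
proof (cases "\<exists>j\<in>F. ecdim (Cj j) = \<infinity>")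
  case True
  then show ?thesis using F by (auto simp: sum.remove)
next
  case False
  then have "\<forall>j\<in>F. \<exists>B \<subseteq> Cj j. finite B \<and> Cj j \<subseteq> complex_vector.span B \<and> ecdim (Cj j) = enat (card B)"
    by (metis basis_of_finite_ecdim)
  then obtain B where B: "\<And>j. j \<in> F \<Longrightarrow> B j \<subseteq> Cj j"
    "\<And>j. j \<in> F \<Longrightarrow> finite (B j)" "\<And>j. j \<in> F \<Longrightarrow> Cj j \<subseteq> complex_vector.span (B j)"
    "\<And>j. j \<in> F \<Longrightarrow> ecdim (Cj j) = enat (card (B j))" by metis
  have BV: "B j \<subseteq> Vj j" if "j \<in> F" for j
    using B(1)[OF that] direct_complementD(5)[OF complj, of j] that F(2) by blast
  have triv': "Vj j \<subseteq> Wj j" if j: "j \<in> J - F" for j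
  proof -
    have "j \<in> J" using j by blast
    obtain D where D: "finite D" "Cj j \<subseteq> complex_vector.span D" "ecdim (Cj j) = enat (card D)"
      using triv[OF j] by (metis basis_of_finite_ecdim enat.distinct(1) zero_enat_def)
    then have "D = {}" using triv[OF j] by (simp add: zero_enat_def)
    then have "Cj j \<subseteq> {0}" using D by simp
    then show ?thesis using direct_complementD(7)[OF complj[OF \<open>j \<in> J\<close>]] by fastforce
  qed
  have "spanning_modulo W V (Sigma F B) (\<lambda>(j, b). P j b)"
    using F B BV triv' by (intro spanning_modulo_Sigma span_imp_spanning_modulo[OF complj]) auto
  then have "ecdim C \<le> enat (card (Sigma F B))"
    using F B BV by (intro spanning_modulo_le_card[OF compl]) (auto intro!: P_Vj subsetD[OF BV])
  also have "enat (card (Sigma F B)) = (\<Sum>j\<in>F. ecdim (Cj j))"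
    using F B(2,4) by (simp flip: of_nat_eq_enat)
  finally show ?thesis .
qed

lemma ecdim_eq_sum:
  assumes F: "finite F" "F \<subseteq> J" and triv: "\<And>j. j \<in> J - F \<Longrightarrow> ecdim (Cj j) = 0"
  shows "ecdim C = (\<Sum>j\<in>F. ecdim (Cj j))"
proof (rule antisym[OF ecdim_le_sum[OF assms]])
  show "(\<Sum>j\<in>F. ecdim (Cj j)) \<le> ecdim C"
  proof (cases "\<exists>k\<in>F. ecdim (Cj k) = \<infinity>")
    case True
    then obtain k where k: "k \<in> F" "ecdim (Cj k) = \<infinity>" by blast
    have "enat n \<le> ecdim C" for n
      using sum_le_ecdim[of "{k}" "\<lambda>_. n"] k F by auto
    then have "ecdim C = \<infinity>" by (metis enat.exhaust enat_ord_simps(1) not_less_eq_eq order_refl)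
    then show ?thesis by simp
  next
    case False
    then have n: "ecdim (Cj j) = enat (the_enat (ecdim (Cj j)))" if "j \<in> F" for j
      using that by (cases "ecdim (Cj j)") auto
    have "(\<Sum>j\<in>F. ecdim (Cj j)) = (\<Sum>j\<in>F. enat (the_enat (ecdim (Cj j))))"
      by (intro sum.cong refl n)
    also have "\<dots> = enat (\<Sum>j\<in>F. the_enat (ecdim (Cj j)))"
      unfolding of_nat_eq_enat[symmetric] by simp
    also have "\<dots> \<le> ecdim C" using n by (intro sum_le_ecdim F) simp
    finally show ?thesis .
  qed
qed

lemma ecdim_infinite:
  assumes "infinite {j \<in> J. ecdim (Cj j) \<noteq> 0}"
  shows "ecdim C = \<infinity>"
proof -
  have "enat n \<le> ecdim C" for n
  proof -
    obtain F where F: "finite F" "card F = n" "F \<subseteq> {j \<in> J. ecdim (Cj j) \<noteq> 0}"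
      using infinite_arbitrarily_large[OF assms] by blast
    have "enat 1 \<le> ecdim (Cj j)" if "j \<in> F" for j
    proof -
      have "1 \<le> ecdim (Cj j)" using that F(3) by (auto simp: one_eSuc ileI1)
      then show ?thesis by (simp only: one_enat_def)
    qed
    then have "enat (\<Sum>j\<in>F. 1) \<le> ecdim C"
      using F by (intro sum_le_ecdim) auto
    then show ?thesis using F by simp
  qed
  then show ?thesis by (metis enat.exhaust enat_ord_simps(1) not_less_eq_eq order_refl)
qed

text \<open>
  Components of dimension zero can be discarded. If finitely many remain, the sum is finite;
  otherwise the terms are bounded below by \<open>1 / 2\<close> and the sum diverges.
\<close>

lemma half_ecdim_eq_infsum:
  "ennreal_of_enat (ecdim C) / 2 = (\<Sum>\<^sub>\<infinity>j\<in>J. ennreal_of_enat (ecdim (Cj j)) / 2)"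
proof -
  let ?K = "{j \<in> J. ecdim (Cj j) \<noteq> 0}"
  have "(\<Sum>\<^sub>\<infinity>j\<in>J. ennreal_of_enat (ecdim (Cj j)) / 2)
      = (\<Sum>\<^sub>\<infinity>j\<in>?K. ennreal_of_enat (ecdim (Cj j)) / 2)"
    by (intro infsum_cong_neutral) auto
  also have "\<dots> = ennreal_of_enat (ecdim C) / 2"
  proof (cases "finite ?K")
    case True
    have "ecdim C = (\<Sum>j\<in>?K. ecdim (Cj j))" using True by (intro ecdim_eq_sum) auto
    then show ?thesis
      using True by (simp add: divide_ennreal_def flip: sum_distrib_right)
  next
    case False
    have "(1 / 2 :: ennreal) \<le> ennreal_of_enat (ecdim (Cj j)) / 2" if "j \<in> ?K" for j
    proof -
      have "1 \<le> ecdim (Cj j)" using that by (simp add: ileI1 one_eSuc)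
      then have "ennreal_of_enat 1 \<le> ennreal_of_enat (ecdim (Cj j))"
        unfolding ennreal_of_enat_le_iff .
      then show ?thesis by (intro divide_right_mono_ennreal) simp
    qed
    then have "(\<Sum>\<^sub>\<infinity>j\<in>?K. ennreal_of_enat (ecdim (Cj j)) / 2) = \<infinity>"
      using False
      by (intro infsum_superconst_infinite_ennreal[where b = "1/2"]) (auto simp: ennreal_zero_less_divide)
    then show ?thesis using ecdim_infinite[OF False] by (simp add: ennreal_top_divide)
  qed
  finally show ?thesis by simp
qed

end

section \<open>Additivity of the defect\<close>

lemma bounded_clinearD:
  assumes "bounded_clinear B"
  shows "B (x + y) = B x + B y" "B (c *\<^sub>C x) = c *\<^sub>C B x" "bounded_linear B"
  using assms by (auto simp: bounded_clinear_def linear_simps)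

theorem theorem4p2:
  fixes J :: "nat set"
    and T :: "'a::chilbert_space \<rightharpoonup> 'a"
    and Tj :: "nat \<Rightarrow> ('a \<rightharpoonup> 'a)"
    and \<Phi>j \<Psi>j :: "nat \<Rightarrow> 'a \<Rightarrow> 'a"  (* \<Psi>j j stands for Phi-tilde_j *)
    and \<Phi> :: "'a \<Rightarrow> 'a"
  assumes separable: "separable_space (euclidean :: 'a topology)"
    and T: "symmetric_operator T" "closed_operator T"
    and Tj: "\<And>j. j \<in> J \<Longrightarrow> symmetric_operator (Tj j)" "\<And>j. j \<in> J \<Longrightarrow> closed_operator (Tj j)"
    and bounded_\<Phi>j: "\<And>j. j \<in> J \<Longrightarrow> bounded_clinear (\<Phi>j j)"
    and bounded_\<Psi>j: "\<And>j. j \<in> J \<Longrightarrow> bounded_clinear (\<Psi>j j)"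
    and bounded_\<Phi>: "bounded_clinear \<Phi>"
    and strong_sum: "\<And>g. (\<lambda>N. \<Sum>j\<in>{j \<in> J. j \<le> N}. \<Phi>j j g) \<longlonglongrightarrow> \<Phi> g"
    and c1: "\<And>j. j \<in> J \<Longrightarrow> \<Psi>j j \<circ> \<Phi>j j = \<Phi>j j"
      "\<And>j k. j \<in> J \<Longrightarrow> k \<in> J \<Longrightarrow> j \<noteq> k \<Longrightarrow> \<Psi>j j \<circ> \<Phi>j k = (\<lambda>_. 0)"
    and c2: "\<And>j g. j \<in> J \<Longrightarrow> g \<in> dom (adjoint_operator (Tj j)) \<Longrightarrow> \<Phi>j j g \<in> dom (adjoint_operator T)"
    and c3: "\<And>j g. j \<in> J \<Longrightarrow> g \<in> dom (adjoint_operator T) \<Longrightarrow> \<Phi>j j g \<in> dom (adjoint_operator (Tj j))"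
    and c4: "\<And>j g. j \<in> J \<Longrightarrow> g \<in> dom (Tj j) \<Longrightarrow> \<Psi>j j g \<in> dom T"
    and c5: "\<And>j g. j \<in> J \<Longrightarrow> g \<in> dom T \<Longrightarrow> \<Psi>j j g \<in> dom (Tj j)"
    and c6: "\<And>j g. j \<in> J \<Longrightarrow> g \<in> dom (adjoint_operator (Tj j)) \<Longrightarrow> g - \<Phi>j j g \<in> dom (Tj j)"
    and c7: "\<And>g. g \<in> dom (adjoint_operator T) \<Longrightarrow> g - \<Phi> g \<in> dom T"
    and c8: "\<And>g. g \<in> dom (adjoint_operator T) \<Longrightarrow>
      (\<lambda>N. the (adjoint_operator T (\<Sum>j\<in>{j \<in> J. j \<le> N}. \<Phi>j j g)))
        \<longlonglongrightarrow> the (adjoint_operator T (\<Phi> g))"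
  shows "defect T = (\<Sum>\<^sub>\<infinity>j\<in>J. defect (Tj j))"
proof -
  let ?V = "dom (adjoint_operator T)" and ?W = "dom T"
  let ?Vj = "\<lambda>j. dom (adjoint_operator (Tj j))" and ?Wj = "\<lambda>j. dom (Tj j)"
  note T' = symmetric_operatorD[OF T(1)]
  note Tj' = symmetric_operatorD[OF Tj(1)]
  have \<Psi>\<Phi>j: "\<Psi>j j (\<Phi>j k g) = (if j = k then \<Phi>j k g else 0)" if "j \<in> J" "k \<in> J" for j k g
    using c1(1)[OF that(1)] c1(2)[OF that] by (auto simp: fun_eq_iff)
  \<comment> \<open>The partial sums from \<open>k\<close> on are all mapped to \<open>\<Phi>j k g\<close>, so the limit is as well.\<close>
  have \<Psi>\<Phi>: "\<Psi>j k (\<Phi> g) = \<Phi>j k g" if k: "k \<in> J" for k g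
  proof -
    note bl = bounded_clinearD(3)[OF bounded_\<Psi>j[OF k]]
    have "\<Psi>j k (\<Sum>j\<in>{j \<in> J. j \<le> N}. \<Phi>j j g) = \<Phi>j k g" if N: "k \<le> N" for N
    proof -
      have "\<Psi>j k (\<Sum>j\<in>{j \<in> J. j \<le> N}. \<Phi>j j g) = (\<Sum>j\<in>{j \<in> J. j \<le> N}. \<Psi>j k (\<Phi>j j g))"
        by (rule linear_sum[OF bounded_linear.linear[OF bl]])
      also have "\<dots> = (\<Sum>j\<in>{j \<in> J. j \<le> N}. if k = j then \<Phi>j j g else 0)"
        using k by (intro sum.cong) (auto simp: \<Psi>\<Phi>j)
      finally show ?thesis using k N by simp
    qed
    then have "\<forall>\<^sub>F N in sequentially. \<Psi>j k (\<Sum>j\<in>{j \<in> J. j \<le> N}. \<Phi>j j g) = \<Phi>j k g"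
      by (auto simp: eventually_sequentially)
    then have "(\<lambda>N. \<Psi>j k (\<Sum>j\<in>{j \<in> J. j \<le> N}. \<Phi>j j g)) \<longlonglongrightarrow> \<Phi>j k g"
      by (rule tendsto_eventually)
    with bounded_linear.tendsto[OF bl strong_sum] show ?thesis by (rule LIMSEQ_unique)
  qed
  interpret quotient_splitting J ?V ?W "deficiency_sum T" ?Vj ?Wj "\<lambda>j. deficiency_sum (Tj j)" \<Phi>j
  proof
    show "direct_complement ?W (deficiency_sum T) ?V"
      by (rule von_neumann_decomposition(1)[OF T])
    show "direct_complement (?Wj j) (deficiency_sum (Tj j)) (?Vj j)" if "j \<in> J" for j
      by (rule von_neumann_decomposition(1)[OF Tj[OF that]])
    show "\<Phi>j j (x + y) = \<Phi>j j x + \<Phi>j j y" "\<Phi>j j (c *\<^sub>C x) = c *\<^sub>C \<Phi>j j x" if "j \<in> J" for j x y c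
      by (rule bounded_clinearD[OF bounded_\<Phi>j[OF that]])+
    show "\<Phi>j j v \<in> ?Vj j" if "j \<in> J" "v \<in> ?V" for j v by (rule c3[OF that])
    show "\<Phi>j j v \<in> ?V" if "j \<in> J" "v \<in> ?Vj j" for j v by (rule c2[OF that])
    show "\<Phi>j j w \<in> ?Wj j" if j: "j \<in> J" and w: "w \<in> ?W" for j w
    proof -
      have "w \<in> ?V" using w T'(6) by blast
      from complex_vector.subspace_diff[OF T'(2) w c7[OF this]]
      have "w - (w - \<Phi> w) \<in> ?W" .
      from c5[OF j this] show ?thesis by (simp add: \<Psi>\<Phi> j)
    qed
    have \<Phi>k\<Phi>j: "\<Psi>j k (\<Phi>j j v) - \<Phi>j k (\<Phi>j j v) \<in> ?Wj k"
      if "j \<in> J" "k \<in> J" "v \<in> ?Vj j" for j k v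
      using c5[OF that(2) c7[OF c2[OF that(1,3)]]]
        linear_diff[OF bounded_linear.linear[OF bounded_clinearD(3)[OF bounded_\<Psi>j[OF that(2)]]]]
      by (simp add: \<Psi>\<Phi> that(2))
    show "\<Phi>j j (\<Phi>j j v) - v \<in> ?Wj j" if j: "j \<in> J" and v: "v \<in> ?Vj j" for j v
    proof -
      have "- ((\<Psi>j j (\<Phi>j j v) - \<Phi>j j (\<Phi>j j v)) + (v - \<Phi>j j v)) \<in> ?Wj j"
        by (intro complex_vector.subspace_neg complex_vector.subspace_add Tj'(2) \<Phi>k\<Phi>j c6 j v)
      then show ?thesis by (simp add: \<Psi>\<Phi>j j algebra_simps)
    qed
    show "\<Phi>j k (\<Phi>j j v) \<in> ?Wj k" if "j \<in> J" "k \<in> J" "j \<noteq> k" "v \<in> ?Vj j" for j k v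
      using complex_vector.subspace_neg[OF Tj'(2)[OF that(2)] \<Phi>k\<Phi>j[OF that(1,2,4)]] that
      by (simp add: \<Psi>\<Phi>j)
    show "v \<in> ?W" if v: "v \<in> ?V" and vj: "\<And>j. j \<in> J \<Longrightarrow> \<Phi>j j v \<in> ?Wj j" for v
    proof -
      define s where "s N = (\<Sum>j\<in>{j \<in> J. j \<le> N}. \<Phi>j j v)" for N
      have "\<Phi>j j v \<in> ?W" if "j \<in> J" for j using c4[OF that vj[OF that]] by (simp add: \<Psi>\<Phi>j that)
      then have s: "s N \<in> ?W" for N
        unfolding s_def by (intro complex_vector.subspace_sum T'(2)) auto
      let ?l = "the (adjoint_operator T (\<Phi> v))"
      have Ts: "(\<lambda>N. the (T (s N))) \<longlonglongrightarrow> ?l"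
        using c8[OF v] T'(3)[OF s] by (simp add: s_def)
      have "s \<longlonglongrightarrow> \<Phi> v" using strong_sum[of v] by (simp add: s_def[abs_def])
      from closed_operator_limit[OF T(2) s this Ts] have "\<Phi> v \<in> ?W" by blast
      from complex_vector.subspace_add[OF T'(2) c7[OF v] this] show ?thesis by simp
    qed
  qed
  have "defect T = ennreal_of_enat (ecdim (deficiency_sum T)) / 2" by (rule defect_eq_ecdim[OF T])
  also have "\<dots> = (\<Sum>\<^sub>\<infinity>j\<in>J. ennreal_of_enat (ecdim (deficiency_sum (Tj j))) / 2)"
    by (rule half_ecdim_eq_infsum)
  also have "\<dots> = (\<Sum>\<^sub>\<infinity>j\<in>J. defect (Tj j))"
    by (intro infsum_cong) (simp add: defect_eq_ecdim Tj)
  finally show ?thesis .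
qed

end
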